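(* Let $\gamma,\alpha>0$, let $(Y_i)_{i\ge1}$ be i.i.d. with Gamma density $\frac{1}{\Gamma(\gamma)}x^{\gamma-1}e^{-x}\mathds{1}_{\{x>0\}}$, and let $G_\alpha$ have Gamma density $\frac{1}{\Gamma(\alpha)}x^{\alpha-1}e^{-x}\mathds{1}_{\{x>0\}}$. For $n\ge1$ let $X_n=\sum_{i=1}^{k_n}\lambda_{i,n}(Y_i-\gamma)$ with $k_n\in\mathbb{N}$ and real weights satisfying $|\lambda_{1,n}|\ge|\lambda_{2,n}|\ge\dots>0$. Assume $X_n+\alpha$ converges in distribution to $G_\alpha$. If $\alpha>6$, then for every $x\in\mathbb{R}$, $\lim_{n\to\infty}p_{X_n+\alpha}(x)=p_{G_\alpha}(x)$, where $p_{X_n+\alpha}$ and $p_{G_\alpha}$ denote the densities. *)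

theory Defs
  imports "HOL-Probability.Probability"
begin

definition gamma_density :: "real \<Rightarrow> real \<Rightarrow> real" where
  "gamma_density g x = (if x > 0 then x powr (g - 1) * exp (- x) / Gamma g else 0)"

text \<open>Density of l * (Y - g) for Y with gamma density of shape g, l nonzero.\<close>
definition scaled_centered_density :: "real \<Rightarrow> real \<Rightarrow> real \<Rightarrow> real" where
  "scaled_centered_density g l y = gamma_density g (y / l + g) / \<bar>l\<bar>"

definition conv_density :: "(real \<Rightarrow> real) \<Rightarrow> (real \<Rightarrow> real) \<Rightarrow> real \<Rightarrow> real" where
  "conv_density f h x = (\<integral>t. f (x - t) * h t \<partial>lborel)"

text \<open>Density of sum over the list ls of l * (Y_l - g), independent Y_l of shape g,
  given as the iterated convolution of the individual densities.\<close>
fun weighted_sum_density :: "real \<Rightarrow> real list \<Rightarrow> real \<Rightarrow> real" where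
  "weighted_sum_density g [] = (\<lambda>_. 0)"
| "weighted_sum_density g [l] = scaled_centered_density g l"
| "weighted_sum_density g (l # ls) =
     conv_density (scaled_centered_density g l) (weighted_sum_density g ls)"

end

theory Submission
  imports Defs "HOL-Real_Asymp.Real_Asymp"
begin

text \<open>The characteristic function of X_n has modulus
  a_n(t) = prod_i (1 + lambda_i^2 t^2)^(- g / 2), and weak convergence gives
  a_n(t) -> (1 + t^2)^(- alpha / 2) pointwise. For alpha > 6 the limit loses a factor of more than
  32 between t = 2 and t = 4, hence so does a_n for large n. As log a_n is concave in log t, the
  loss at all later doublings is at least as large, which gives an integrable majorant of the a_n
  that does not depend on n; Fourier inversion and dominated convergence then yield convergence of
  the densities. A single factor loses at most 2^g between t = 2 and t = 4, so
  g * k_n >= 5 for large n. This makes the inversion formula valid at every point: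
  either k_n = 1 and the density is continuous, or g * (k_n - 1) >= 2 and the characteristic
  function of the sum without its first term is already integrable.\<close>

subsection \<open>Fourier inversion for probability densities\<close>

definition fourier :: "(real \<Rightarrow> real) \<Rightarrow> real \<Rightarrow> complex" where
  "fourier f t = (CLBINT x. iexp (t * x) * complex_of_real (f x))"

definition inverse_fourier :: "(real \<Rightarrow> complex) \<Rightarrow> real \<Rightarrow> complex" where
  "inverse_fourier F x = 1 / (2 * pi) * (CLBINT t. iexp (- (t * x)) * F t)"

definition prob_density :: "(real \<Rightarrow> real) \<Rightarrow> bool" where
  "prob_density f \<longleftrightarrow> (\<forall>x. 0 \<le> f x) \<and> has_bochner_integral lborel f 1"

lemma prob_densityD:
  assumes "prob_density f"
  shows "0 \<le> f x" "integrable lborel f" "f \<in> borel_measurable borel" "(\<integral>x. f x \<partial>lborel) = 1"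
  using assms by (auto simp: prob_density_def has_bochner_integral_iff dest: borel_measurable_integrable)

lemma real_distribution_density:
  assumes "prob_density f"
  shows "real_distribution (density lborel (\<lambda>x. ennreal (f x)))"
proof (rule real_distribution.intro)
  note [measurable] = prob_densityD(3)[OF assms]
  show "prob_space (density lborel (\<lambda>x. ennreal (f x)))"
    using prob_densityD[OF assms]
    by (intro prob_spaceI) (simp add: emeasure_density nn_integral_eq_integral)
qed (auto simp: real_distribution_axioms_def)

text \<open>Identifies \<open>fourier\<close> with the library's \<open>char\<close>, which makes
  Levy's inversion and continuity theorems available.\<close>

lemma char_density:
  assumes "prob_density f"
  shows "char (density lborel (\<lambda>x. ennreal (f x))) = fourier f"
proof
  fix t
  note [measurable] = prob_densityD(3)[OF assms]
  show "char (density lborel (\<lambda>x. ennreal (f x))) t = fourier f t"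
    unfolding char_def fourier_def
    by (subst integral_density) (auto simp: prob_densityD(1)[OF assms] scaleR_conv_of_real mult.commute)
qed

lemma fourier_measurable:
  assumes "prob_density f"
  shows "fourier f \<in> borel_measurable borel"
proof -
  interpret real_distribution "density lborel (\<lambda>x. ennreal (f x))"
    by (rule real_distribution_density[OF assms])
  show ?thesis
    using char_measurable by (simp add: char_density[OF assms])
qed

lemma integrable_iexp_mult:
  fixes F :: "real \<Rightarrow> complex"
  assumes "integrable lborel F"
  shows "integrable lborel (\<lambda>t. iexp (c * t) * F t)"
proof (rule Bochner_Integration.integrable_bound[OF assms])
  note [measurable] = borel_measurable_integrable[OF assms]
  show "(\<lambda>t. iexp (c * t) * F t) \<in> borel_measurable lborel"
    by measurable
qed (simp add: norm_mult)

lemma integrable_iexp_minus_mult: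
  fixes F :: "real \<Rightarrow> complex"
  assumes "integrable lborel F"
  shows "integrable lborel (\<lambda>t. iexp (- (t * x)) * F t)"
  using integrable_iexp_mult[OF assms, of "-x"] by (simp add: mult.commute)

text \<open>Dominated convergence along sequences: the exponential has modulus 1, so
  \<open>norm (F t)\<close> is a majorant for every \<open>x\<close>.\<close>

lemma continuous_inverse_fourier:
  assumes "integrable lborel F"
  shows "continuous_on UNIV (inverse_fourier F)"
proof -
  note [measurable] = borel_measurable_integrable[OF assms]
  have "isCont (\<lambda>x. CLBINT t. iexp (- (t * x)) * F t) x" for x
    unfolding continuous_at_sequentially
  proof safe
    fix X assume X: "X \<longlonglongrightarrow> x"
    show "((\<lambda>x. CLBINT t. iexp (- (t * x)) * F t) \<circ> X) \<longlonglongrightarrow> (CLBINT t. iexp (- (t * x)) * F t)"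
      unfolding comp_def
      by (rule integral_dominated_convergence[where w="\<lambda>t. norm (F t)"])
         (use assms in \<open>auto intro!: tendsto_intros X simp: norm_mult\<close>)
  qed
  then show ?thesis
    unfolding inverse_fourier_def
    by (intro continuous_intros continuous_at_imp_continuous_on) auto
qed

text \<open>The right-hand side is the kernel of Levy's inversion formula; writing it as an integral
  turns that formula into a double integral.\<close>

lemma integral_iexp_Ioc:
  fixes a b t :: real
  assumes "a \<le> b" "t \<noteq> 0"
  shows "(CLBINT x. indicator {a<..b} x *\<^sub>R iexp (- (t * x))) = (iexp (-(t * a)) - iexp (-(t * b))) / (\<i> * t)"
proof -
  have "(CLBINT x. indicator {a<..b} x *\<^sub>R iexp (- (t * x))) = (CLBINT x=a..b. iexp (- (t * x)))"
    using assms by (simp add: interval_integral_Ioc set_lebesgue_integral_def)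
  also have "\<dots> = \<i> / t * iexp (- (t * b)) - \<i> / t * iexp (- (t * a))"
    using assms
    by (intro interval_integral_FTC_finite)
       (auto intro!: continuous_intros derivative_eq_intros simp: has_vector_derivative_complex_iff Re_exp Im_exp)
  also have "\<dots> = (iexp (-(t * a)) - iexp (-(t * b))) / (\<i> * t)"
    using assms by (simp add: field_simps)
  finally show ?thesis .
qed

text \<open>Justifies Fubini for that double integral: the modulus is constant in \<open>x\<close>
  on the interval, so the inner integral of the norm is a fixed multiple of
  \<open>norm (F t)\<close>.\<close>

lemma integrable_Ioc_iexp_pair:
  assumes "integrable lborel F"
  shows "integrable (lborel \<Otimes>\<^sub>M lborel) (\<lambda>(t, x). indicator {a<..b} x *\<^sub>R (iexp (- (t * x)) * F t))"
proof -
  note [measurable] = borel_measurable_integrable[OF assms]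
  show ?thesis
  proof (rule lborel_pair.Fubini_integrable)
    show "integrable lborel (\<lambda>t. LBINT x. norm (case (t, x) of (t, x) \<Rightarrow> indicator {a<..b} x *\<^sub>R (iexp (- (t * x)) * F t)))"
      using assms by (simp add: norm_mult)
    have "integrable lborel (\<lambda>x. indicator {a<..b} x *\<^sub>R (iexp (- (t * x)) * F t))" for t
      by (rule integrableI_bounded_set_indicator[where B="norm (F t)"])
         (auto simp: norm_mult intro!: emeasure_bounded_finite[unfolded infinity_ennreal_def])
    then show "AE t in lborel. integrable lborel (\<lambda>x. case (t, x) of (t, x) \<Rightarrow> indicator {a<..b} x *\<^sub>R (iexp (- (t * x)) * F t))"
      by simp
  qed measurable
qed

text \<open>Levy's formula gives the measure as a limit of integrals from \<open>-T\<close> to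
  \<open>T\<close>. Integrability of the transform replaces the limit by one integral over the line,
  and Fubini moves the integral over \<open>x\<close> outside.\<close>

lemma measure_Ioc_eq_inverse_fourier:
  assumes f: "prob_density f" and F: "integrable lborel (fourier f)" and "a \<le> b"
  shows "complex_of_real (measure (density lborel (\<lambda>x. ennreal (f x))) {a<..b})
    = (CLBINT x. indicator {a<..b} x *\<^sub>R inverse_fourier (fourier f) x)"
proof -
  let ?M = "density lborel (\<lambda>x. ennreal (f x))" and ?F = "fourier f"
  interpret real_distribution ?M by (rule real_distribution_density[OF f])
  note [measurable] = prob_densityD(3)[OF f] fourier_measurable[OF f]
  let ?K = "\<lambda>t. (iexp (-(t * a)) - iexp (-(t * b))) / (\<i> * t)"
  \<comment> \<open>Levy's formula asks for endpoints that carry no mass.\<close>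
  have null: "measure ?M {c} = 0" for c
  proof -
    have "emeasure ?M {c} = (\<integral>\<^sup>+x. ennreal (f x) * indicator {c} x \<partial>lborel)"
      by (simp add: emeasure_density)
    also have "\<dots> = 0"
      by (intro nn_integral_null_set) (auto simp: null_sets_def)
    finally show ?thesis by (simp add: measure_def)
  qed
  have K_bound: "norm (?K t) \<le> b - a" if "t \<noteq> 0" for t
    using Levy_Inversion_aux2[OF \<open>a \<le> b\<close>, of "-t"] that
    by (simp add: norm_divide norm_mult norm_minus_commute)
  have bound: "AE t in lborel. norm (?K t * ?F t) \<le> (b - a) * norm (?F t)"
    using AE_lborel_singleton[of 0]
    by eventually_elim (subst norm_mult, intro mult_right_mono K_bound norm_ge_zero)
  have lim: "(\<lambda>T::nat. CLBINT t=-real T..real T. ?K t * ?F t) \<longlonglongrightarrow> (CLBINT t. ?K t * ?F t)"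
  proof -
    have "(\<lambda>T::nat. CLBINT t. indicator {-real T<..<real T} t *\<^sub>R (?K t * ?F t)) \<longlonglongrightarrow> (CLBINT t. ?K t * ?F t)"
    proof (rule integral_dominated_convergence[where w="\<lambda>t. (b - a) * norm (?F t)"])
      show "AE t in lborel. (\<lambda>T::nat. indicator {-real T<..<real T} t *\<^sub>R (?K t * ?F t)) \<longlonglongrightarrow> ?K t * ?F t"
      proof (intro AE_I2 tendsto_eventually)
        fix t :: real
        have "\<forall>\<^sub>F T::nat in sequentially. \<bar>t\<bar> < real T"
          using filterlim_real_sequentially by (simp add: filterlim_at_top_dense)
        then show "\<forall>\<^sub>F T::nat in sequentially. indicator {-real T<..<real T} t *\<^sub>R (?K t * ?F t) = ?K t * ?F t"
          by eventually_elim (auto simp: indicator_def abs_less_iff)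
      qed
      show "AE t in lborel. norm (indicator {-real T<..<real T} t *\<^sub>R (?K t * ?F t)) \<le> (b - a) * norm (?F t)" for T :: nat
        using bound by eventually_elim (use \<open>a \<le> b\<close> in \<open>auto split: split_indicator\<close>)
    qed (use F in auto)
    then show ?thesis
      by (simp add: interval_lebesgue_integral_def set_lebesgue_integral_def)
  qed
  have "(\<lambda>T::nat. 1 / (2 * pi) * (CLBINT t=-real T..real T. ?K t * ?F t)) \<longlonglongrightarrow> measure ?M {a<..b}"
    using Levy_Inversion[OF \<open>a \<le> b\<close> null null]
    by (simp add: char_density[OF f])
  then have "complex_of_real (measure ?M {a<..b}) = 1 / (2 * pi) * (CLBINT t. ?K t * ?F t)"
    by (rule LIMSEQ_unique) (intro tendsto_intros lim)
  also have "(CLBINT t. ?K t * ?F t) = (CLBINT t. CLBINT x. indicator {a<..b} x *\<^sub>R (iexp (- (t * x)) * ?F t))"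
  proof (rule integral_cong_AE)
    \<comment> \<open>At \<open>t = 0\<close> the kernel is 0 by the convention for division instead
      of its limit \<open>b - a\<close>, so the identity is stated almost everywhere.\<close>
    show "AE t in lborel. ?K t * ?F t = (CLBINT x. indicator {a<..b} x *\<^sub>R (iexp (- (t * x)) * ?F t))"
      using AE_lborel_singleton[of 0]
    proof eventually_elim
      fix t :: real assume "t \<noteq> 0"
      have "?K t * ?F t = (CLBINT x. indicator {a<..b} x *\<^sub>R iexp (- (t * x))) * ?F t"
        by (simp only: integral_iexp_Ioc[OF \<open>a \<le> b\<close> \<open>t \<noteq> 0\<close>])
      also have "\<dots> = (CLBINT x. (indicator {a<..b} x *\<^sub>R iexp (- (t * x))) * ?F t)"
        by (rule integral_mult_left_zero[symmetric])
      finally show "?K t * ?F t = (CLBINT x. indicator {a<..b} x *\<^sub>R (iexp (- (t * x)) * ?F t))"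
        by (simp only: mult_scaleR_left)
    qed
  qed measurable
  also have "\<dots> = (CLBINT x. CLBINT t. indicator {a<..b} x *\<^sub>R (iexp (- (t * x)) * ?F t))"
    by (intro lborel_pair.Fubini_integral[symmetric] integrable_Ioc_iexp_pair F)
  also have "\<dots> = (CLBINT x. indicator {a<..b} x *\<^sub>R (CLBINT t. iexp (- (t * x)) * ?F t))"
    by (simp only: integral_scaleR_right)
  also have "1 / (2 * pi) * \<dots> = (CLBINT x. 1 / (2 * pi) * (indicator {a<..b} x *\<^sub>R (CLBINT t. iexp (- (t * x)) * ?F t)))"
    by (rule integral_mult_right_zero[symmetric])
  finally show ?thesis
    by (simp only: inverse_fourier_def mult_scaleR_right)
qed

text \<open>Levy's inversion formula is a statement about intervals, so the continuous function
  on the right has nonnegative integral over each of them and is itself nonnegative.\<close>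
lemma density_eq_inverse_fourier_AE:
  assumes f: "prob_density f" and F: "integrable lborel (fourier f)"
  shows "AE x in lborel. f x = Re (inverse_fourier (fourier f) x)"
proof -
  let ?M = "density lborel (\<lambda>x. ennreal (f x))" and ?q = "\<lambda>x. Re (inverse_fourier (fourier f) x)"
  interpret real_distribution ?M by (rule real_distribution_density[OF f])
  have cont: "continuous_on UNIV ?q"
    by (intro continuous_intros continuous_inverse_fourier F)
  have cont': "continuous_on UNIV (inverse_fourier (fourier f))"
    by (intro continuous_inverse_fourier F)
  note [measurable] = prob_densityD(3)[OF f] borel_measurable_continuous_onI[OF cont] borel_measurable_continuous_onI[OF cont']
  have int: "integrable lborel (\<lambda>x. indicator {a<..b} x *\<^sub>R inverse_fourier (fourier f) x)" for a b
  proof -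
    have "set_integrable lborel {a..b} (inverse_fourier (fourier f))"
      by (intro borel_integrable_atLeastAtMost' continuous_on_subset[OF cont']) auto
    then have "set_integrable lborel {a<..b} (inverse_fourier (fourier f))"
      by (rule set_integrable_subset) auto
    then show ?thesis by (simp add: set_integrable_def)
  qed
  have int_q: "integrable lborel (\<lambda>x. indicator {a<..b} x * ?q x)" for a b
    using integrable_Re[OF int[of a b]] by simp
  have meas: "measure ?M {a<..b} = (LBINT x. indicator {a<..b} x * ?q x)" if "a \<le> b" for a b
    using arg_cong[where f=Re, OF measure_Ioc_eq_inverse_fourier[OF f F that]] 
       integral_Re[OF int[of a b], symmetric]
    by simp
  \<comment> \<open>By continuity a negative value would persist on a short interval to the right,
    whose measure would then be negative.\<close>
  have nonneg: "0 \<le> ?q x" for x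
  proof (rule ccontr)
    assume "\<not> 0 \<le> ?q x"
    then have "?q x < 0" by simp
    have "?q \<midarrow>x\<rightarrow> ?q x"
      using cont by (simp add: continuous_on_eq_continuous_at isCont_def)
    then have "\<forall>\<^sub>F y in at x. ?q y < ?q x / 2"
      using \<open>?q x < 0\<close> by (intro order_tendstoD(2)) auto
    then obtain d where d: "d > 0" "\<And>y. y \<noteq> x \<Longrightarrow> \<bar>y - x\<bar> < d \<Longrightarrow> ?q y < ?q x / 2"
      by (auto simp: eventually_at dist_real_def)
    define b where "b = x + d / 2"
    have "0 \<le> measure ?M {x<..b}" by simp
    also have "\<dots> = (LBINT y. indicator {x<..b} y * ?q y)"
      using d by (intro meas) (simp add: b_def)
    also have "\<dots> \<le> (LBINT y. indicator {x<..b} y * (?q x / 2))"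
    proof (rule integral_mono[OF int_q])
      show "indicator {x<..b} y * ?q y \<le> indicator {x<..b} y * (?q x / 2)" for y
        using d(1) d(2)[of y] by (auto simp: b_def split: split_indicator)
    qed (auto intro!: integrable_mult_left integrable_real_indicator emeasure_bounded_finite)
    also have "\<dots> = d / 2 * (?q x / 2)"
      using d by (simp add: b_def)
    also have "\<dots> < 0"
      using d \<open>?q x < 0\<close> by (intro mult_pos_neg) auto
    finally show False by simp
  qed
  \<comment> \<open>Half-open intervals form an intersection-stable generator, so agreement on them
    suffices. Nonnegativity of \<open>?q\<close> matters because \<open>ennreal\<close> cuts off
    negative values.\<close>
  have "?M = density lborel (\<lambda>x. ennreal (?q x))"
  proof (rule measure_eqI_generator_eq[where \<Omega>=UNIV])
    fix X assume "X \<in> range (\<lambda>(a, b). {a<..b::real})"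
    then obtain a b where X: "X = {a<..b}" by auto
    show "emeasure ?M X = emeasure (density lborel (\<lambda>x. ennreal (?q x))) X"
    proof (cases "a \<le> b")
      case True
      have "emeasure ?M X = ennreal (LBINT x. indicator {a<..b} x * ?q x)"
        using meas[OF True] by (simp add: X emeasure_eq_measure)
      also have "\<dots> = (\<integral>\<^sup>+x. ennreal (indicator {a<..b} x * ?q x) \<partial>lborel)"
        using nonneg by (intro nn_integral_eq_integral[symmetric] int_q) auto
      also have "\<dots> = emeasure (density lborel (\<lambda>x. ennreal (?q x))) X"
        by (auto simp: X emeasure_density intro!: nn_integral_cong split: split_indicator)
      finally show ?thesis .
    qed (simp add: X)
  next
    show "(\<Union>i. {- real (i::nat)<..real i}) = UNIV"
      by (rule UN_Ioc_eq_UNIV)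
  qed (auto simp: borel_sigma_sets_Ioc Int_stable_def)
  then have "AE x in lborel. ennreal (f x) = ennreal (?q x)"
    by (subst (asm) sigma_finite_measure.density_unique_iff[OF sigma_finite_lborel]) auto
  then show ?thesis
    by eventually_elim (use nonneg prob_densityD(1)[OF f] in auto)
qed

text \<open>The set where the functions differ is open and null, and a nonempty open set is never
  negligible.\<close>

lemma continuous_AE_eq_lborel:
  fixes f h :: "real \<Rightarrow> real"
  assumes "continuous_on UNIV f" "continuous_on UNIV h" "AE x in lborel. f x = h x"
  shows "f = h"
proof -
  have "open {x. f x \<noteq> h x}"
    by (intro open_Collect_neq assms)
  moreover from this have "{x. f x \<noteq> h x} \<in> null_sets lborel"
    using assms(3) by (subst (asm) AE_iff_null) auto
  then have "negligible {x. f x \<noteq> h x}"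
    unfolding negligible_iff_null_sets by (rule null_sets_completionI)
  ultimately have "{x. f x \<noteq> h x} = {}"
    using open_not_negligible by blast
  then show ?thesis by auto
qed

lemma continuous_density_eq_inverse_fourier:
  assumes "prob_density f" "integrable lborel (fourier f)" "continuous_on UNIV f"
  shows "f x = Re (inverse_fourier (fourier f) x)"
proof -
  have "f = (\<lambda>x. Re (inverse_fourier (fourier f) x))"
    by (intro continuous_AE_eq_lborel assms density_eq_inverse_fourier_AE continuous_on_Re continuous_inverse_fourier)
  then show ?thesis by (rule fun_cong)
qed

subsection \<open>The Fourier transform of the gamma density\<close>

lemma prob_density_gamma:
  assumes "g > 0"
  shows "prob_density (gamma_density g)"
proof -
  have G: "Gamma g > 0" using assms by (rule Gamma_real_pos)
  have "(\<integral>\<^sup>+x. ennreal (gamma_density g x) \<partial>lborel)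
      = (\<integral>\<^sup>+x. ennreal (1 / Gamma g) * ennreal (indicator {0..} x * x powr (g - 1) / exp x) \<partial>lborel)"
    using G by (intro nn_integral_cong)
      (auto simp: gamma_density_def exp_minus field_simps ennreal_mult[symmetric] split: split_indicator)
  also have "\<dots> = ennreal (1 / Gamma g) * ennreal (Gamma g)"
    using assms by (subst nn_integral_cmult) (auto simp: Gamma_conv_nn_integral_real)
  also have "\<dots> = ennreal 1"
    using G by (simp add: ennreal_mult[symmetric])
  finally have "(\<integral>\<^sup>+x. ennreal (gamma_density g x) \<partial>lborel) = ennreal 1" .
  moreover have "0 \<le> gamma_density g x" for x
    using G by (simp add: gamma_density_def)
  moreover have "gamma_density g \<in> borel_measurable lborel"
    unfolding gamma_density_def by measurable
  ultimately show ?thesis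
    unfolding prob_density_def by (auto intro!: has_bochner_integral_nn_integral)
qed

lemma Gamma_Suc_pos:
  assumes "(g::real) > 0"
  shows "Gamma (g + 1) = g * Gamma g"
  using assms by (intro Gamma_plus1) (auto elim!: nonpos_Ints_cases)

text \<open>Factors of \<open>x\<close> are absorbed into the shape, so the moments that occur when
  the transform is differentiated are again multiples of gamma densities.\<close>

lemma gamma_density_Suc:
  assumes "g > 0"
  shows "x * gamma_density g x = g * gamma_density (g + 1) x"
proof (cases "x > 0")
  case True
  have "x * gamma_density g x = x powr g * exp (- x) / Gamma g"
    using True by (simp add: gamma_density_def powr_diff)
  also have "\<dots> = g * (x powr g * exp (- x) / (g * Gamma g))"
    using assms by simp
  also have "\<dots> = g * gamma_density (g + 1) x"
    using True by (simp add: gamma_density_def Gamma_Suc_pos[OF assms])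
  finally show ?thesis .
qed (simp add: gamma_density_def)

lemma has_real_derivative_gamma_density_Suc:
  assumes "g > 0" "x > 0"
  shows "(gamma_density (g + 1) has_real_derivative gamma_density g x - gamma_density (g + 1) x) (at x)"
proof -
  have "((\<lambda>x. x powr g * exp (- x) / (g * c)) has_real_derivative
      x powr (g - 1) * exp (- x) / c - x powr g * exp (- x) / (g * c)) (at x)" if "c \<noteq> 0" for c
    using assms that by (auto intro!: derivative_eq_intros simp: powr_diff field_simps)
  from this[of "Gamma g"] have "((\<lambda>x. x powr g * exp (- x) / (g * Gamma g)) has_real_derivative
      x powr (g - 1) * exp (- x) / Gamma g - x powr g * exp (- x) / (g * Gamma g)) (at x)"
    using Gamma_real_pos[OF assms(1)] by simp
  moreover have "\<forall>\<^sub>F y in nhds x. gamma_density (g + 1) y = y powr g * exp (- y) / (g * Gamma g)"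
    using eventually_nhds_in_open[of "{0<..}" x] assms
    by (auto elim!: eventually_mono simp: gamma_density_def Gamma_Suc_pos)
  ultimately show ?thesis
    using assms by (subst DERIV_cong_ev[OF refl _ refl]) (auto simp: gamma_density_def Gamma_Suc_pos)
qed

lemma integrable_iexp_mult_real:
  assumes "integrable lborel f"
  shows "integrable lborel (\<lambda>x. iexp (t * x) * complex_of_real (f x))"
  using integrable_iexp_mult[of "\<lambda>x. complex_of_real (f x)" t] assms by simp

text \<open>The second moment makes the Taylor remainder of the exponential integrable.\<close>
lemma has_vector_derivative_fourier:
  assumes f: "prob_density f" and "integrable lborel (\<lambda>x. x * f x)" "integrable lborel (\<lambda>x. x\<^sup>2 * f x)"
  shows "(fourier f has_vector_derivative \<i> * fourier (\<lambda>x. x * f x) t) (at t)"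
proof -
  define D where "D = \<i> * fourier (\<lambda>x. x * f x) t"
  define C where "C = (LBINT x. x\<^sup>2 * f x)"
  note int = prob_densityD(2)[OF f] assms(2,3)
  \<comment> \<open>An error of the difference quotient that is linear in \<open>h\<close> gives
    differentiability; at \<open>h = 0\<close> the left side is 0 by the convention for
    division.\<close>
  have bound: "norm (fourier f (t + h) - fourier f t - h *\<^sub>R D) / norm h \<le> C * \<bar>h\<bar>" for h
  proof -
    let ?r = "\<lambda>x. iexp ((t + h) * x) * complex_of_real (f x) - iexp (t * x) * complex_of_real (f x)
          - complex_of_real h * \<i> * (iexp (t * x) * complex_of_real (x * f x))"
    note ints = integrable_iexp_mult_real[OF int(1)] integrable_iexp_mult_real[OF int(2)]
    \<comment> \<open>Factoring out the exponential at \<open>t\<close> leaves the first-order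
      Taylor remainder of \<open>iexp (h * x)\<close>, which is quadratic in
      \<open>h * x\<close>.\<close>
    have r_eq: "?r x = iexp (t * x) * complex_of_real (f x) * (iexp (h * x) - (1 + \<i> * complex_of_real (h * x)))" for x
      by (simp add: algebra_simps exp_add)
    have "norm (iexp (h * x) - (1 + \<i> * complex_of_real (h * x))) \<le> (h * x)\<^sup>2" for x
    proof -
      have "norm (iexp (h * x) - (1 + \<i> * complex_of_real (h * x))) \<le> (h * x)\<^sup>2 / 2"
        using iexp_approx1[of "h * x" 1] by (simp add: numeral_2_eq_2)
      then show ?thesis by (smt (verit) field_sum_of_halves zero_le_power2)
    qed
    then have "f x * norm (iexp (h * x) - (1 + \<i> * complex_of_real (h * x))) \<le> f x * (h * x)\<^sup>2" for x
      by (intro mult_left_mono prob_densityD(1)[OF f])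
    then have r_le: "norm (?r x) \<le> h\<^sup>2 * (x\<^sup>2 * f x)" for x
      unfolding r_eq norm_mult norm_exp_i_times norm_of_real abs_of_nonneg[OF prob_densityD(1)[OF f, of x]]
      by (metis (no_types, lifting) mult.commute mult.left_commute mult_1 power_mult_distrib)
    have "fourier f (t + h) - fourier f t - h *\<^sub>R D = (CLBINT x. ?r x)"
      unfolding fourier_def D_def scaleR_conv_of_real
      using ints by (simp only: Bochner_Integration.integral_diff Bochner_Integration.integrable_diff
         integrable_mult_right integral_mult_right_zero mult.assoc)
    also have "norm \<dots> \<le> (LBINT x. h\<^sup>2 * (x\<^sup>2 * f x))"
      by (intro Bochner_Integration.integral_norm_bound_integral r_le Bochner_Integration.integrable_diff ints integrable_mult_right assms(3))
    finally have "norm (fourier f (t + h) - fourier f t - h *\<^sub>R D) \<le> C * \<bar>h\<bar> * \<bar>h\<bar>"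
      by (simp add: C_def power2_eq_square mult.commute)
    then show ?thesis
      by (cases "h = 0") (auto simp: field_simps)
  qed
  have "((\<lambda>h. C * \<bar>h\<bar>) \<longlongrightarrow> C * \<bar>0\<bar>) (at 0)"
    by (intro tendsto_intros)
  then have lim: "((\<lambda>h. C * \<bar>h\<bar>) \<longlongrightarrow> 0) (at 0)"
    by simp
  have "((\<lambda>h. norm (fourier f (t + h) - fourier f t - h *\<^sub>R D) / norm h) \<longlongrightarrow> 0) (at 0)"
  proof (rule Lim_null_comparison[OF always_eventually lim], intro allI)
    show "norm (norm (fourier f (t + h) - fourier f t - h *\<^sub>R D) / norm h) \<le> C * \<bar>h\<bar>" for h
      using bound[of h] by (simp only: real_norm_def abs_divide abs_norm_cancel abs_abs)
  qed
  then show ?thesis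
    unfolding has_vector_derivative_def has_derivative_at D_def[symmetric]
    by (simp add: bounded_linear_scaleR_left)
qed

lemma fourier_cmult: "fourier (\<lambda>x. c * f x) t = complex_of_real c * fourier f t"
proof -
  have "fourier (\<lambda>x. c * f x) t = (CLBINT x. complex_of_real c * (iexp (t * x) * complex_of_real (f x)))"
    unfolding fourier_def by (simp add: ac_simps)
  then show ?thesis by (simp add: fourier_def)
qed

text \<open>Differentiation raises the shape by one. Combined with a relation between the transforms
  of shapes \<open>g\<close> and \<open>g + 1\<close>, this becomes a linear differential
  equation.\<close>

lemma has_vector_derivative_fourier_gamma:
  assumes "g > 0"
  shows "(fourier (gamma_density g) has_vector_derivative \<i> * g * fourier (gamma_density (g + 1)) t) (at t)"
proof -
  have 1: "(\<lambda>x. x * gamma_density g x) = (\<lambda>x. g * gamma_density (g + 1) x)"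
    using gamma_density_Suc[OF assms] by auto
  have "x\<^sup>2 * gamma_density g x = g * ((g + 1) * gamma_density (g + 1 + 1) x)" for x
  proof -
    have "x\<^sup>2 * gamma_density g x = x * (x * gamma_density g x)" by (simp add: power2_eq_square)
    also have "\<dots> = g * (x * gamma_density (g + 1) x)" by (simp add: gamma_density_Suc[OF assms])
    also have "\<dots> = g * ((g + 1) * gamma_density (g + 1 + 1) x)"
      using assms by (subst gamma_density_Suc) auto
    finally show ?thesis .
  qed
  then have 2: "(\<lambda>x. x\<^sup>2 * gamma_density g x) = (\<lambda>x. g * ((g + 1) * gamma_density (g + 1 + 1) x))"
    by auto
  show ?thesis
    using has_vector_derivative_fourier[OF prob_density_gamma[OF assms], of t]
      prob_densityD(2)[OF prob_density_gamma[of "g + 1"]] prob_densityD(2)[OF prob_density_gamma[of "g + 1 + 1"]] assms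
    unfolding 1 2 fourier_cmult by (simp add: mult.assoc)
qed

text \<open>Integration by parts on the positive half-line: there \<open>?f\<close> is the
  derivative of \<open>?F\<close>, and \<open>?F\<close> tends to 0 at both ends.\<close>

lemma fourier_gamma_Suc:
  assumes "g > 0"
  shows "fourier (gamma_density g) t = (1 - \<i> * t) * fourier (gamma_density (g + 1)) t"
proof -
  let ?F = "\<lambda>x. iexp (t * x) * complex_of_real (gamma_density (g + 1) x)"
  let ?f = "\<lambda>x. iexp (t * x) * complex_of_real (gamma_density g x)
     - (1 - \<i> * t) * (iexp (t * x) * complex_of_real (gamma_density (g + 1) x))"
  have G: "Gamma (g + 1) = g * Gamma g" "Gamma g > 0"
    using assms by (auto simp: Gamma_Suc_pos)
  have ints: "integrable lborel (\<lambda>x. iexp (t * x) * complex_of_real (gamma_density g x))"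
     "integrable lborel (\<lambda>x. iexp (t * x) * complex_of_real (gamma_density (g + 1) x))"
    using assms by (auto intro!: integrable_iexp_mult_real prob_densityD(2)[OF prob_density_gamma] simp del: of_real_mult)
  have int: "integrable lborel ?f"
    by (intro Bochner_Integration.integrable_diff integrable_mult_right ints)
  have deriv: "(?F has_vector_derivative ?f x) (at x)" if "x > 0" for x
  proof -
    have "((\<lambda>x. iexp (t * x)) has_vector_derivative \<i> * t * iexp (t * x)) (at x)"
      by (auto intro!: derivative_eq_intros simp: has_vector_derivative_complex_iff Re_exp Im_exp)
    from has_vector_derivative_mult[OF this has_vector_derivative_of_real[OF
          has_real_derivative_gamma_density_Suc[OF assms that]]]
    show ?thesis by (simp add: algebra_simps)
  qed
  have cont: "isCont ?f x" if "x > 0" for x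
  proof -
    have "isCont (gamma_density s) x" for s
    proof -
      have "isCont (\<lambda>x. x powr (s - 1) * exp (- x) / Gamma s) x"
        using that by (cases "Gamma s = 0") (auto intro!: continuous_intros)
      moreover have "\<forall>\<^sub>F y in nhds x. gamma_density s y = y powr (s - 1) * exp (- y) / Gamma s"
        using eventually_nhds_in_open[of "{0<..}" x] that
        by (auto elim!: eventually_mono simp: gamma_density_def)
      ultimately show ?thesis by (subst isCont_cong) auto
    qed
    then show ?thesis by (intro continuous_intros)
  qed
  have norm_F: "norm (?F x) = gamma_density (g + 1) x" for x
    unfolding norm_mult norm_exp_i_times norm_of_real
    using prob_densityD(1)[OF prob_density_gamma[of "g + 1"]] assms by simp
  have "(LBINT x=0..\<infinity>. ?f x) = 0 - 0"
  proof (rule interval_integral_FTC_integrable)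
    show "set_integrable lborel (einterval 0 \<infinity>) ?f"
      unfolding set_integrable_def by (rule integrable_mult_indicator[OF _ int]) simp
    \<comment> \<open>Shape \<open>g + 1\<close> makes the boundary term at 0 vanish for every
      \<open>g > 0\<close>, although the density of shape \<open>g\<close> is unbounded there when
      \<open>g < 1\<close>.\<close>
    have "((\<lambda>x. x powr g * exp (- x)) \<longlongrightarrow> 0) (at_right 0)"
      using assms by real_asymp
    then have "((\<lambda>x. x powr g * exp (- x) / Gamma (g + 1)) \<longlongrightarrow> 0) (at_right 0)"
      by (rule tendsto_divide_zero)
    moreover have "\<forall>\<^sub>F x in at_right 0. norm (?F x) \<le> x powr g * exp (- x) / Gamma (g + 1)"
      using eventually_at_right_less[of 0] by eventually_elim (simp only: norm_F, simp add: gamma_density_def)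
    ultimately show "((?F \<circ> real_of_ereal) \<longlongrightarrow> 0) (at_right 0)"
      unfolding zero_ereal_def ereal_tendsto_simps by (rule Lim_null_comparison[rotated])
    have "((\<lambda>x. x powr g * exp (- x)) \<longlongrightarrow> 0) at_top"
      using assms by real_asymp
    then have "((\<lambda>x. x powr g * exp (- x) / Gamma (g + 1)) \<longlongrightarrow> 0) at_top"
      by (rule tendsto_divide_zero)
    moreover have "\<forall>\<^sub>F x in at_top. norm (?F x) \<le> x powr g * exp (- x) / Gamma (g + 1)"
      using eventually_gt_at_top[of 0] by eventually_elim (simp only: norm_F, simp add: gamma_density_def)
    ultimately show "((?F \<circ> real_of_ereal) \<longlongrightarrow> 0) (at_left \<infinity>)"
      unfolding ereal_tendsto_simps by (rule Lim_null_comparison[rotated])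
  qed (use deriv cont in \<open>auto simp flip: zero_ereal_def\<close>)
  moreover have "(LBINT x=0..\<infinity>. ?f x) = (LBINT x. ?f x)"
    unfolding interval_lebesgue_integral_def set_lebesgue_integral_def
    by (auto intro!: Bochner_Integration.integral_cong split: split_indicator simp: einterval_def gamma_density_def)
  ultimately have "(LBINT x. ?f x) = 0" by simp
  then show ?thesis
    using ints by (simp add: fourier_def)
qed

text \<open>The transform solves y' = i g y / (1 - i t), so its product with (1 - i t)^g is
  constant, equal to its value 1 at 0. The modulus of 1 - i t is sqrt (1 + t^2).\<close>

lemma norm_fourier_gamma:
  assumes "g > 0"
  shows "norm (fourier (gamma_density g) t) = (1 + t\<^sup>2) powr (- g / 2)"
proof -
  let ?\<phi> = "fourier (gamma_density g)"
  let ?P = "\<lambda>t::real. exp (g * Ln (1 - \<i> * t))"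
  \<comment> \<open>The positive real part keeps the argument of \<open>Ln\<close> off the branch
    cut, so \<open>?P\<close> is differentiable at every real \<open>t\<close>.\<close>
  have pos: "Re (1 - \<i> * t) > 0" for t :: real by simp
  have nz: "1 - \<i> * t \<noteq> 0" for t :: real using pos[of t] by (metis less_irrefl zero_complex.sel(1))
  have d\<phi>: "(?\<phi> has_vector_derivative \<i> * g * ?\<phi> t / (1 - \<i> * t)) (at t)" for t
    using has_vector_derivative_fourier_gamma[OF assms, of t] nz[of t] by (simp add: fourier_gamma_Suc[OF assms] mult.assoc)
  have dP: "(?P has_vector_derivative ?P t * (g * (- \<i> / (1 - \<i> * t)))) (at t)" for t
  proof -
    have "((\<lambda>z. exp (g * Ln (1 - \<i> * z))) has_field_derivative ?P t * (g * (- \<i> / (1 - \<i> * t)))) (at (complex_of_real t))"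
      using pos[of t] by (auto intro!: derivative_eq_intros simp: complex_nonpos_Reals_iff divide_inverse)
    from has_vector_derivative_real_field[OF this] show ?thesis by simp
  qed
  have "((\<lambda>t. ?\<phi> t * ?P t) has_vector_derivative 0) (at t)" for t
    using has_vector_derivative_mult[OF d\<phi>[of t] dP[of t]] by simp
  then have "(\<lambda>t. ?\<phi> t * ?P t) t = (\<lambda>t. ?\<phi> t * ?P t) 0"
    by (intro has_derivative_zero_unique[of UNIV]) (auto simp: has_vector_derivative_def)
  moreover have "?\<phi> 0 = 1"
    using prob_densityD(4)[OF prob_density_gamma[OF assms]] by (simp add: fourier_def)
  ultimately have "norm (?\<phi> t) * norm (?P t) = 1"
    by (metis (no_types, lifting) Ln_1 diff_zero exp_zero mult_zero_right norm_mult norm_one of_real_0 mult_1)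
  moreover have pos1: "1 + t\<^sup>2 \<noteq> 0"
    using zero_le_power2[of t] by linarith
  moreover have "norm (?P t) = (1 + t\<^sup>2) powr (g / 2)"
  proof -
    have "norm (?P t) = exp (g * ln (cmod (1 - \<i> * t)))"
      unfolding norm_exp_eq_Re using nz[of t] by (simp add: Re_complex_of_real del: complex_Re_numeral)
    also have "cmod (1 - \<i> * t) = sqrt (1 + t\<^sup>2)"
      by (simp add: cmod_def)
    also have "exp (g * ln (sqrt (1 + t\<^sup>2))) = (1 + t\<^sup>2) powr (g / 2)"
      by (simp add: powr_def ln_sqrt add_pos_nonneg pos1)
    finally show ?thesis .
  qed
  ultimately show ?thesis
    by (simp add: powr_minus field_simps)
qed

subsection \<open>Convolutions\<close>

lemma prob_density_affine:
  assumes "prob_density f" "l \<noteq> 0"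
  shows "prob_density (\<lambda>y. f (y / l + c) / \<bar>l\<bar>)"
proof -
  have "has_bochner_integral lborel f 1"
    using assms by (simp add: prob_density_def)
  then have "has_bochner_integral lborel (\<lambda>y. f (c + 1 / l * y)) (1 /\<^sub>R \<bar>1 / l\<bar>)"
    using assms by (subst (asm) lborel_has_bochner_integral_real_affine_iff[of "1 / l" _ _ c]) auto
  then have "has_bochner_integral lborel (\<lambda>y. f (c + 1 / l * y) / \<bar>l\<bar>) ((1 /\<^sub>R \<bar>1 / l\<bar>) / \<bar>l\<bar>)"
    by (rule has_bochner_integral_divide_zero)
  moreover have "(1 /\<^sub>R \<bar>1 / l\<bar>) / \<bar>l\<bar> = 1"
    using assms by (simp add: field_simps)
  ultimately show ?thesis
    using prob_densityD(1)[OF assms(1)] by (simp add: prob_density_def add.commute)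
qed

lemma fourier_affine:
  assumes "l \<noteq> 0"
  shows "fourier (\<lambda>y. f (y / l + c) / \<bar>l\<bar>) t = iexp (- (t * (l * c))) * fourier f (l * t)"
proof -
  let ?h = "\<lambda>y. iexp (t * y) * complex_of_real (f (y / l + c) / \<bar>l\<bar>)"
  have "?h (- (l * c) + l * x) * complex_of_real \<bar>l\<bar> = iexp (- (t * (l * c))) * (iexp (l * t * x) * complex_of_real (f x))" for x
  proof -
    have "(- (l * c) + l * x) / l + c = x"
      using assms by (simp add: diff_divide_distrib)
    then have "?h (- (l * c) + l * x) * complex_of_real \<bar>l\<bar> = iexp (t * (- (l * c) + l * x)) * complex_of_real (f x)"
      using assms by (simp del: of_real_mult of_real_add)
    moreover have "iexp (t * (- (l * c) + l * x)) = iexp (- (t * (l * c))) * iexp (l * t * x)"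
      by (simp add: exp_add[symmetric] algebra_simps)
    ultimately show ?thesis
      by (simp only: mult.assoc)
  qed
  then have "(CLBINT x. ?h (- (l * c) + l * x) * complex_of_real \<bar>l\<bar>)
     = (CLBINT x. iexp (- (t * (l * c))) * (iexp (l * t * x) * complex_of_real (f x)))"
    by (simp only:)
  moreover have "fourier (\<lambda>y. f (y / l + c) / \<bar>l\<bar>) t = \<bar>l\<bar> *\<^sub>R (CLBINT x. ?h (- (l * c) + l * x))"
    unfolding fourier_def by (rule lborel_integral_real_affine[OF assms])
  ultimately show ?thesis
    by (simp only: integral_mult_right_zero integral_mult_left_zero scaleR_conv_of_real fourier_def mult.commute)
qed

lemma prob_density_scaled_centered:
  assumes "g > 0" "l \<noteq> 0"
  shows "prob_density (scaled_centered_density g l)"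
  unfolding scaled_centered_density_def[abs_def]
  by (intro prob_density_affine prob_density_gamma assms)

lemma fourier_scaled_centered:
  assumes "l \<noteq> 0"
  shows "fourier (scaled_centered_density g l) t = iexp (- (t * (l * g))) * fourier (gamma_density g) (l * t)"
  unfolding scaled_centered_density_def[abs_def] by (rule fourier_affine[OF assms])

lemma norm_fourier_scaled_centered:
  assumes "g > 0" "l \<noteq> 0"
  shows "norm (fourier (scaled_centered_density g l) t) = (1 + l\<^sup>2 * t\<^sup>2) powr (- g / 2)"
  by (simp only: fourier_scaled_centered[OF assms(2)] norm_mult norm_exp_i_times
      norm_fourier_gamma[OF assms(1)] power_mult_distrib mult_1)

section \<open>Translations and the convolution of two densities\<close>

lemma integrable_shift_minus:
  fixes f :: "real \<Rightarrow> 'a :: {banach, second_countable_topology}"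
  assumes "integrable lborel f"
  shows "integrable lborel (\<lambda>x. f (x - t))" "integrable lborel (\<lambda>x. f (t - x))"
  using lborel_integrable_real_affine[OF assms, of 1 "-t"] lborel_integrable_real_affine[OF assms, of "-1" t]
  by simp_all

lemma integral_shift_minus:
  fixes f :: "real \<Rightarrow> 'a :: {banach, second_countable_topology}"
  shows "(\<integral>x. f (x - t) \<partial>lborel) = (\<integral>x. f x \<partial>lborel)" "(\<integral>x. f (t - x) \<partial>lborel) = (\<integral>x. f x \<partial>lborel)"
  using lborel_integral_real_affine[of 1 f "-t"] lborel_integral_real_affine[of "-1" f t]
  by simp_all

lemma integrable_conv_pair:
  assumes f: "prob_density f" and h: "prob_density h"
  shows "integrable (lborel \<Otimes>\<^sub>M lborel) (\<lambda>(t, x). f (x - t) * h t)"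
proof (rule lborel_pair.Fubini_integrable)
  note [measurable] = prob_densityD(3)[OF f] prob_densityD(3)[OF h]
  show "(\<lambda>(t, x). f (x - t) * h t) \<in> borel_measurable (lborel \<Otimes>\<^sub>M lborel)"
    by measurable
  have "(LBINT x. norm (f (x - t) * h t)) = h t" for t
    using integral_shift_minus(1)[of f t] prob_densityD[OF f] prob_densityD(1)[OF h]
    by (simp add: abs_mult)
  then show "integrable lborel (\<lambda>t. LBINT x. norm (case (t, x) of (t, x) \<Rightarrow> f (x - t) * h t))"
    using prob_densityD(2)[OF h] by simp
  show "AE t in lborel. integrable lborel (\<lambda>x. case (t, x) of (t, x) \<Rightarrow> f (x - t) * h t)"
    using integrable_shift_minus(1)[OF prob_densityD(2)[OF f]] by simp
qed

lemma prob_density_conv: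
  assumes f: "prob_density f" and h: "prob_density h"
  shows "prob_density (conv_density f h)"
proof -
  have nonneg: "0 \<le> conv_density f h x" for x
    unfolding conv_density_def using prob_densityD(1)[OF f] prob_densityD(1)[OF h] by simp
  note int = integrable_conv_pair[OF assms]
  have "integrable lborel (conv_density f h)"
    using lborel_pair.integrable_fst'[OF lborel_pair.integrable_product_swap[OF int]]
    by (simp add: conv_density_def[abs_def])
  moreover have "(LBINT x. conv_density f h x) = (LBINT t. LBINT x. f (x - t) * h t)"
    unfolding conv_density_def by (rule lborel_pair.Fubini_integral[OF int])
  moreover have "\<dots> = 1"
    using integral_shift_minus(1)[of f] prob_densityD(4)[OF f] prob_densityD(4)[OF h] by simp
  ultimately show ?thesis
    using nonneg by (simp add: prob_density_def has_bochner_integral_iff)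
qed

text \<open>The exponential at \<open>x\<close> is the product of those at \<open>x - t\<close> and
  \<open>t\<close>, so Fubini and translation invariance separate the double integral.\<close>

lemma fourier_conv:
  assumes f: "prob_density f" and h: "prob_density h"
  shows "fourier (conv_density f h) s = fourier f s * fourier h s"
proof -
  note [measurable] = prob_densityD(3)[OF f] prob_densityD(3)[OF h]
  let ?K = "\<lambda>t x. iexp (s * x) * complex_of_real (f (x - t) * h t)"
  have int: "integrable (lborel \<Otimes>\<^sub>M lborel) (case_prod ?K)"
  proof (rule Bochner_Integration.integrable_bound[OF integrable_conv_pair[OF assms]])
    show "case_prod ?K \<in> borel_measurable (lborel \<Otimes>\<^sub>M lborel)"
      by measurable
    show "AE p in lborel \<Otimes>\<^sub>M lborel. norm (case_prod ?K p) \<le> norm (case p of (t, x) \<Rightarrow> f (x - t) * h t)"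
      by (intro AE_I2) (simp only: split_beta norm_mult norm_exp_i_times norm_of_real real_norm_def abs_mult mult_1 order_refl)
  qed
  have "fourier (conv_density f h) s = (CLBINT x. CLBINT t. ?K t x)"
    unfolding fourier_def conv_density_def
    by (simp only: integral_mult_right_zero integral_complex_of_real)
  also have "\<dots> = (CLBINT t. CLBINT x. ?K t x)"
    by (rule lborel_pair.Fubini_integral[OF int])
  also have "\<dots> = (CLBINT t. fourier f s * (iexp (s * t) * complex_of_real (h t)))"
  proof (rule Bochner_Integration.integral_cong[OF refl])
    fix t
    have "?K t x = (iexp (s * (x - t)) * complex_of_real (f (x - t))) * (iexp (s * t) * complex_of_real (h t))" for x
      by (simp add: right_diff_distrib exp_diff)
    then have "(CLBINT x. ?K t x) = (CLBINT x. iexp (s * (x - t)) * complex_of_real (f (x - t))) * (iexp (s * t) * complex_of_real (h t))"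
      by (simp only: integral_mult_left_zero)
    then show "(CLBINT x. ?K t x) = fourier f s * (iexp (s * t) * complex_of_real (h t))"
      by (simp only: integral_shift_minus(1)[of "\<lambda>x. iexp (s * x) * complex_of_real (f x)"] fourier_def)
  qed
  finally show ?thesis
    by (simp only: integral_mult_right_zero fourier_def)
qed

text \<open>The inversion formula for the second factor only holds almost everywhere, but
  integrating it against the first factor gives an identity at every point.\<close>
lemma conv_density_eq_inverse_fourier:
  assumes f: "prob_density f" and h: "prob_density h" and H: "integrable lborel (fourier h)"
  shows "conv_density f h x = Re (inverse_fourier (\<lambda>s. fourier f s * fourier h s) x)"
proof -
  let ?q = "inverse_fourier (fourier h)"
  let ?K = "\<lambda>t s. complex_of_real (f (x - t)) * (iexp (- (s * t)) * fourier h s)"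
  note [measurable] = prob_densityD(3)[OF f] prob_densityD(3)[OF h] fourier_measurable[OF h]
    borel_measurable_continuous_onI[OF continuous_inverse_fourier[OF H]]
  have fx: "integrable lborel (\<lambda>t. f (x - t))"
    by (intro integrable_shift_minus prob_densityD[OF f])
  have int: "integrable (lborel \<Otimes>\<^sub>M lborel) (case_prod ?K)"
  proof (rule lborel_pair.Fubini_integrable)
    show "case_prod ?K \<in> borel_measurable (lborel \<Otimes>\<^sub>M lborel)"
      by measurable
    have "(LBINT s. norm (?K t s)) = f (x - t) * (LBINT s. norm (fourier h s))" for t
      using prob_densityD(1)[OF f] by (simp add: norm_mult)
    then show "integrable lborel (\<lambda>t. LBINT s. norm (case (t, s) of (t, s) \<Rightarrow> ?K t s))"
      using fx by simp
    show "AE t in lborel. integrable lborel (\<lambda>s. case (t, s) of (t, s) \<Rightarrow> ?K t s)"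
      unfolding prod.case by (intro AE_I2 integrable_mult_right integrable_iexp_minus_mult H)
  qed
  \<comment> \<open>The double integral of \<open>?K\<close> is evaluated in both orders: over
    \<open>s\<close> first it inverts the transform of \<open>h\<close>, over \<open>t\<close> first
    it produces the transform of \<open>f\<close>.\<close>
  have K1: "(CLBINT s. ?K t s) = complex_of_real (f (x - t)) * ?q t * complex_of_real (2 * pi)" for t
    by (simp add: inverse_fourier_def)
  have int1: "integrable lborel (\<lambda>t. complex_of_real (f (x - t)) * ?q t)"
  proof -
    have "integrable lborel (\<lambda>t. complex_of_real (f (x - t)) * ?q t * complex_of_real (2 * pi))"
      using lborel_pair.integrable_fst'[OF int] by (simp only: prod.case K1)
    from integrable_divide_zero[OF this, of "complex_of_real (2 * pi)"] show ?thesis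
      by simp
  qed
  have K2: "(CLBINT t. ?K t s) = iexp (- (s * x)) * (fourier f s * fourier h s)" for s
  proof -
    have "?K t s = iexp (s * (x - t)) * complex_of_real (f (x - t)) * (iexp (- (s * x)) * fourier h s)" for t
      by (simp add: right_diff_distrib exp_diff exp_minus field_simps)
    then have "(CLBINT t. ?K t s) = (CLBINT t. iexp (s * (x - t)) * complex_of_real (f (x - t))) * (iexp (- (s * x)) * fourier h s)"
      by (simp only: integral_mult_left_zero)
    also have "\<dots> = fourier f s * (iexp (- (s * x)) * fourier h s)"
      by (simp only: integral_shift_minus(2)[of "\<lambda>x. iexp (s * x) * complex_of_real (f x)"] fourier_def)
    finally show ?thesis by (simp only: mult.left_commute)
  qed
  have "conv_density f h x = (LBINT t. Re (complex_of_real (f (x - t)) * ?q t))"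
    unfolding conv_density_def
  proof (rule integral_cong_AE)
    show "AE t in lborel. f (x - t) * h t = Re (complex_of_real (f (x - t)) * ?q t)"
      using density_eq_inverse_fourier_AE[OF h H] by eventually_elim simp
  qed measurable
  also have "\<dots> = Re (CLBINT t. complex_of_real (f (x - t)) * ?q t)"
    by (rule integral_Re[OF int1])
  also have "(CLBINT t. complex_of_real (f (x - t)) * ?q t) = 1 / (2 * pi) * (CLBINT t. CLBINT s. ?K t s)"
    unfolding K1 by simp
  also have "(CLBINT t. CLBINT s. ?K t s) = (CLBINT s. CLBINT t. ?K t s)"
    by (rule lborel_pair.Fubini_integral[OF int, symmetric])
  finally show ?thesis
    unfolding K2 inverse_fourier_def .
qed

section \<open>Iterated convolutions\<close>

text \<open>The empty sum is a point mass without a density, and the empty list is given the zero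
  function. The recursion is therefore uniform only for a nonempty tail, and inductions start at
  singletons.\<close>

lemma weighted_sum_density_Cons:
  "ls \<noteq> [] \<Longrightarrow> weighted_sum_density g (l # ls) = conv_density (scaled_centered_density g l) (weighted_sum_density g ls)"
  by (cases ls) auto

lemma prob_density_weighted_sum:
  assumes "g > 0" "ls \<noteq> []" "0 \<notin> set ls"
  shows "prob_density (weighted_sum_density g ls)"
  using assms(2,3)
proof (induction ls rule: list_nonempty_induct)
  case (cons l ls)
  then show ?case
    by (simp add: weighted_sum_density_Cons prob_density_conv prob_density_scaled_centered assms)
qed (simp add: prob_density_scaled_centered assms)

lemma fourier_weighted_sum:
  assumes "g > 0" "ls \<noteq> []" "0 \<notin> set ls"
  shows "fourier (weighted_sum_density g ls) t = (\<Prod>l\<leftarrow>ls. fourier (scaled_centered_density g l) t)"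
  using assms(2,3)
proof (induction ls rule: list_nonempty_induct)
  case (cons l ls)
  then show ?case
    by (simp add: weighted_sum_density_Cons fourier_conv prob_density_weighted_sum prob_density_scaled_centered assms)
qed simp

subsection \<open>Decay of the characteristic function\<close>

definition char_modulus :: "real \<Rightarrow> real list \<Rightarrow> real \<Rightarrow> real" where
  "char_modulus g ls t = (\<Prod>l\<leftarrow>ls. (1 + l\<^sup>2 * t\<^sup>2) powr (- g / 2))"

lemma one_plus_square_pos: "0 < 1 + l\<^sup>2 * (t::real)\<^sup>2"
  by (intro add_pos_nonneg) auto

lemma norm_prod_fourier_eq_char_modulus:
  assumes "g > 0" "0 \<notin> set ls"
  shows "norm (\<Prod>l\<leftarrow>ls. fourier (scaled_centered_density g l) t) = char_modulus g ls t"
  using assms(2)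
  by (induction ls) (auto simp: char_modulus_def norm_mult norm_fourier_scaled_centered[OF assms(1)])

lemma char_modulus_pos: "0 < char_modulus g ls t"
  using one_plus_square_pos by (induction ls) (auto simp: char_modulus_def intro!: mult_pos_pos simp: less_imp_neq[symmetric])

lemma char_modulus_le_1:
  assumes "g > 0"
  shows "char_modulus g ls t \<le> 1"
proof (induction ls)
  case (Cons l ls)
  have "(1 + l\<^sup>2 * t\<^sup>2) powr (- g / 2) \<le> (1 + l\<^sup>2 * t\<^sup>2) powr 0"
    using assms by (intro powr_mono) auto
  then have "(1 + l\<^sup>2 * t\<^sup>2) powr (- g / 2) \<le> 1"
    using one_plus_square_pos[of l t] by (simp add: less_imp_neq[symmetric])
  then have "(1 + l\<^sup>2 * t\<^sup>2) powr (- g / 2) * char_modulus g ls t \<le> 1 * 1"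
    using Cons char_modulus_pos[of g ls t] by (intro mult_mono) auto
  then show ?case by (simp add: char_modulus_def)
qed (simp add: char_modulus_def)

text \<open>The logarithm of the modulus is a concave function of log t, so the drop from 2 to 4
  bounds the drop at every later doubling.\<close>
lemma char_modulus_doubling:
  assumes "g > 0" "t \<ge> 2"
  shows "char_modulus g ls (2 * t) * char_modulus g ls 2 \<le> char_modulus g ls t * char_modulus g ls 4"
proof (induction ls)
  case (Cons l ls)
  let ?p = "\<lambda>t. (1 + l\<^sup>2 * t\<^sup>2) powr (- g / 2)"
  \<comment> \<open>This is the difference of the two products compared next: the terms of degree 0
    and 4 in \<open>l\<close> cancel.\<close>
  have "0 \<le> 3 * l\<^sup>2 * (t\<^sup>2 - 4)"
    using power_mono[OF assms(2), of 2] by simp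
  then have "(1 + l\<^sup>2 * t\<^sup>2) * (1 + l\<^sup>2 * 4\<^sup>2) \<le> (1 + l\<^sup>2 * (2 * t)\<^sup>2) * (1 + l\<^sup>2 * 2\<^sup>2)"
    by (simp add: algebra_simps power2_eq_square)
  then have "((1 + l\<^sup>2 * (2 * t)\<^sup>2) * (1 + l\<^sup>2 * 2\<^sup>2)) powr (- g / 2) \<le> ((1 + l\<^sup>2 * t\<^sup>2) * (1 + l\<^sup>2 * 4\<^sup>2)) powr (- g / 2)"
    using assms(1) by (intro powr_mono2' mult_pos_pos one_plus_square_pos) auto
  then have "?p (2 * t) * ?p 2 \<le> ?p t * ?p 4"
    by (simp only: powr_mult)
  then have "(?p (2 * t) * ?p 2) * (char_modulus g ls (2 * t) * char_modulus g ls 2)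
      \<le> (?p t * ?p 4) * (char_modulus g ls t * char_modulus g ls 4)"
    by (rule mult_mono[OF _ Cons]) (auto intro!: mult_nonneg_nonneg simp: char_modulus_pos[THEN less_imp_le])
  then show ?case by (simp add: char_modulus_def mult_ac)
qed (simp add: char_modulus_def)

text \<open>Losing a factor 4 at each doubling means decay of order t^(-2). The constant depends
  neither on \<open>g\<close> nor on \<open>ls\<close>, so the bound can serve as a common
  majorant.\<close>

lemma char_modulus_decay:
  assumes g: "g > 0" and drop: "4 * char_modulus g ls 4 \<le> char_modulus g ls 2"
  shows "char_modulus g ls t \<le> 32 / (1 + t\<^sup>2)"
proof -
  have half: "char_modulus g ls (2 * t) \<le> char_modulus g ls t / 4" if "t \<ge> 2" for t
  proof -
    have "char_modulus g ls (2 * t) * (4 * char_modulus g ls 4) \<le> char_modulus g ls (2 * t) * char_modulus g ls 2"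
      using drop char_modulus_pos[of g ls "2 * t"] by (intro mult_left_mono) auto
    also have "\<dots> \<le> char_modulus g ls t * char_modulus g ls 4"
      by (rule char_modulus_doubling[OF g that])
    finally have "char_modulus g ls 4 * (4 * char_modulus g ls (2 * t)) \<le> char_modulus g ls 4 * char_modulus g ls t"
      by (simp add: mult_ac)
    then show ?thesis
      using char_modulus_pos[of g ls 4] by simp
  qed
  \<comment> \<open>Base block of the dyadic induction: here 16 / t^2 is at least 1, and the modulus
    never exceeds 1.\<close>
  have small: "char_modulus g ls t \<le> 16 / t\<^sup>2" if "2 \<le> t" "t \<le> 4" for t
  proof -
    have "t\<^sup>2 \<le> 4\<^sup>2" using that by (intro power_mono) auto
    then have "1 \<le> 16 / t\<^sup>2" using that by simp
    then show ?thesis using char_modulus_le_1[OF g, of ls t] by linarith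
  qed
  have dyadic: "char_modulus g ls t \<le> 16 / t\<^sup>2" if "2 \<le> t" "t \<le> 4 * 2 ^ n" for t n
    using that
  proof (induction n arbitrary: t)
    case (Suc n)
    show ?case
    proof (cases "t \<le> 4")
      case False
      then have "char_modulus g ls (t / 2) \<le> 16 / (t / 2)\<^sup>2"
        using Suc by (intro Suc.IH) auto
      then show ?thesis
        using half[of "t / 2"] False by (simp add: power_divide)
    qed (use small Suc in auto)
  qed (use small in auto)
  have large: "char_modulus g ls t \<le> 16 / t\<^sup>2" if "2 \<le> t" for t
  proof -
    obtain n where "t < 2 ^ n" using real_arch_pow[of 2 t] by auto
    then have "t \<le> 4 * 2 ^ n" using that by linarith
    with that show ?thesis by (rule dyadic)
  qed
  have abs: "char_modulus g ls t = char_modulus g ls \<bar>t\<bar>"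
    by (simp add: char_modulus_def)
  show ?thesis
  proof (cases "\<bar>t\<bar> \<ge> 2")
    case True
    then have "1 \<le> t\<^sup>2" using power_mono[of 2 "\<bar>t\<bar>" 2] by simp
    \<comment> \<open>As 1 + t^2 is at most 2 t^2, the constant 16 for large arguments becomes
      32.\<close>
    then have "32 / (2 * t\<^sup>2) \<le> 32 / (1 + t\<^sup>2)"
      by (intro divide_left_mono mult_pos_pos) linarith+
    then show ?thesis using large[OF True] abs by simp
  next
    case False
    then have "t\<^sup>2 \<le> 2\<^sup>2" using power_mono[of "\<bar>t\<bar>" 2 2] by simp
    then have "1 \<le> 32 / (1 + t\<^sup>2)" using one_plus_square_pos[of 1 t] by (simp add: field_simps)
    then show ?thesis using char_modulus_le_1[OF g, of ls t] by linarith
  qed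
qed

text \<open>For each weight 1 + 16 l^2 is at most 4 (1 + 4 l^2), so one factor loses at most 4^(g/2)
  = 2^g between 2 and 4.\<close>

lemma char_modulus_ratio_le:
  assumes "g > 0"
  shows "char_modulus g ls 2 \<le> 2 powr (g * length ls) * char_modulus g ls 4"
proof (induction ls)
  case (Cons l ls)
  let ?p = "\<lambda>t. (1 + l\<^sup>2 * t\<^sup>2) powr (- g / 2)"
  have "1 + l\<^sup>2 * 4\<^sup>2 \<le> 4 * (1 + l\<^sup>2 * 2\<^sup>2)"
    by simp
  then have "(4 * (1 + l\<^sup>2 * 2\<^sup>2)) powr (- g / 2) \<le> ?p 4"
    using assms by (intro powr_mono2' one_plus_square_pos) auto
  then have "4 powr (- g / 2) * ?p 2 \<le> ?p 4"
    by (simp only: powr_mult)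
  also have "4 powr (- g / 2) = (2 powr 2) powr (- g / 2)"
    by simp
  also have "\<dots> = inverse (2 powr g)"
    by (simp only: powr_powr) (simp add: powr_minus)
  finally have "?p 2 \<le> 2 powr g * ?p 4"
    by (simp add: field_simps)
  then have "?p 2 * char_modulus g ls 2 \<le> (2 powr g * ?p 4) * (2 powr (g * length ls) * char_modulus g ls 4)"
    using Cons char_modulus_pos[of g ls 2] by (intro mult_mono) auto
  then show ?case
    by (simp add: char_modulus_def distrib_left powr_add mult_ac)
qed (simp add: char_modulus_def)

text \<open>Since 32 = 2^5, such a drop needs a total exponent of at least 5. Information on the
  limit thus becomes a lower bound on the number of summands.\<close>

lemma length_ge_of_drop:
  assumes "g > 0" "32 * char_modulus g ls 4 \<le> char_modulus g ls 2"
  shows "5 \<le> g * length ls"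
proof -
  have "32 * char_modulus g ls 4 \<le> 2 powr (g * length ls) * char_modulus g ls 4"
    using assms char_modulus_ratio_le[OF assms(1), of ls] by linarith
  then have "2 powr 5 \<le> 2 powr (g * length ls)"
    using char_modulus_pos[of g ls 4] by simp
  then show ?thesis
    by (subst (asm) powr_le_cancel_iff) auto
qed

section \<open>Integrability of the transforms and pointwise inversion\<close>

lemma integrable_inverse_one_plus_square: "integrable lborel (\<lambda>t::real. c / (1 + t\<^sup>2))"
  using integrable_inverse_1_plus_square
  by (simp add: set_integrable_def einterval_def divide_inverse)

text \<open>A common lower bound for the squared weights merges all factors into one power with
  exponent at most -1. The constant depends on the list, so this serves integrability for a fixed
  list and not domination along the sequence.\<close>

lemma char_modulus_le_of_length:
  fixes g :: real
  assumes "g > 0" "2 \<le> g * length ls" "0 \<notin> set ls"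
  obtains C where "\<And>t. char_modulus g ls t \<le> C / (1 + t\<^sup>2)"
proof -
  \<comment> \<open>Inserting 1 ensures \<open>c \<le> 1\<close>, which yields
    \<open>c * (1 + t\<^sup>2) \<le> 1 + c * t\<^sup>2\<close> at the end.\<close>
  define c where "c = Min (insert 1 ((\<lambda>l. l\<^sup>2) ` set ls))"
  have "c > 0" "c \<le> 1" and c: "\<And>l. l \<in> set ls \<Longrightarrow> c \<le> l\<^sup>2"
    using assms(3) by (auto simp: c_def)
  have pos: "0 < 1 + c * t\<^sup>2" for t
    using \<open>c > 0\<close> by (intro add_pos_nonneg) auto
  have "char_modulus g ls t \<le> (1 + c * t\<^sup>2) powr (- g / 2 * length ls)" for t
    using c
  proof (induction ls)
    case (Cons l ls)
    have "(1 + l\<^sup>2 * t\<^sup>2) powr (- g / 2) \<le> (1 + c * t\<^sup>2) powr (- g / 2)"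
      using assms(1) Cons.prems pos by (intro powr_mono2') (auto intro!: mult_right_mono)
    then have "(1 + l\<^sup>2 * t\<^sup>2) powr (- g / 2) * char_modulus g ls t
        \<le> (1 + c * t\<^sup>2) powr (- g / 2) * (1 + c * t\<^sup>2) powr (- g / 2 * length ls)"
      using Cons char_modulus_pos[of g ls t] by (intro mult_mono) auto
    then show ?case
      by (simp add: char_modulus_def powr_add[symmetric] distrib_left)
  qed (use pos[of t] in \<open>simp add: char_modulus_def\<close>)
  also have "(1 + c * t\<^sup>2) powr (- g / 2 * length ls) \<le> (1 + c * t\<^sup>2) powr (- 1)" for t
    using assms(2) \<open>c > 0\<close> by (intro powr_mono) auto
  also have "(1 + c * t\<^sup>2) powr (- 1) \<le> (1 / c) / (1 + t\<^sup>2)" for t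
  proof -
    have "0 < c * (1 + t\<^sup>2)"
      using \<open>c > 0\<close> one_plus_square_pos[of 1 t] by simp
    moreover have "c * (1 + t\<^sup>2) \<le> 1 + c * t\<^sup>2"
      using \<open>c \<le> 1\<close> by (simp add: distrib_left)
    ultimately have "1 / (1 + c * t\<^sup>2) \<le> 1 / (c * (1 + t\<^sup>2))"
      by (rule frac_le[OF zero_le_one order_refl])
    then show ?thesis
      using pos[of t] by (simp add: powr_minus_divide)
  qed
  finally show ?thesis using that by blast
qed

lemma integrable_fourier_weighted_sum:
  fixes g :: real
  assumes "g > 0" "2 \<le> g * length ls" "0 \<notin> set ls"
  shows "integrable lborel (fourier (weighted_sum_density g ls))"
proof -
  have ne: "ls \<noteq> []" using assms(2) by auto
  obtain C where C: "\<And>t. char_modulus g ls t \<le> C / (1 + t\<^sup>2)"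
    using char_modulus_le_of_length[OF assms] by blast
  note [measurable] = fourier_measurable[OF prob_density_weighted_sum[OF assms(1) ne assms(3)]]
  show ?thesis
  proof (rule Bochner_Integration.integrable_bound[OF integrable_inverse_one_plus_square[of C]])
    show "AE t in lborel. norm (fourier (weighted_sum_density g ls) t) \<le> norm (C / (1 + t\<^sup>2))"
      using order_trans[OF C abs_ge_self]
      by (simp add: fourier_weighted_sum[OF assms(1) ne assms(3)] norm_prod_fourier_eq_char_modulus[OF assms(1,3)])
  qed measurable
qed

lemma integrable_fourier_gamma:
  assumes "g \<ge> 2"
  shows "integrable lborel (fourier (gamma_density g))"
proof (rule Bochner_Integration.integrable_bound[OF integrable_inverse_one_plus_square[of 1]])
  show "fourier (gamma_density g) \<in> borel_measurable lborel"
    using fourier_measurable[OF prob_density_gamma] assms by simp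
  have "(1 + t\<^sup>2) powr (- g / 2) \<le> (1 + t\<^sup>2) powr (- 1)" for t
    using assms by (intro powr_mono) auto
  moreover have "(1 + t\<^sup>2) powr (- 1) = 1 / (1 + t\<^sup>2)" for t :: real
    using one_plus_square_pos[of 1 t] by (simp add: powr_minus_divide)
  ultimately show "AE t in lborel. norm (fourier (gamma_density g) t) \<le> norm (1 / (1 + t\<^sup>2))"
    using assms by (simp add: norm_fourier_gamma)
qed

text \<open>A positive exponent makes \<open>powr\<close> continuous at base 0; the maximum encodes
  the vanishing on the negative axis, because 0 to any power is 0 for \<open>powr\<close>.\<close>

lemma continuous_gamma_density:
  assumes "g > 1"
  shows "continuous_on UNIV (gamma_density g)"
proof -
  have "gamma_density g = (\<lambda>x. max 0 x powr (g - 1) * exp (- x) / Gamma g)"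
    by (auto simp: gamma_density_def fun_eq_iff max_def)
  then show ?thesis
    using assms less_imp_neq[OF Gamma_real_pos[of g]] by (auto intro!: continuous_intros continuous_on_powr')
qed

text \<open>The head is split off because the pointwise formula for a convolution asks for an
  integrable transform of the second factor only.\<close>

lemma weighted_sum_density_eq_inverse_fourier:
  fixes g :: real
  assumes "g > 0" "5 \<le> g * length ls" "0 \<notin> set ls"
  shows "weighted_sum_density g ls x = Re (inverse_fourier (fourier (weighted_sum_density g ls)) x)"
proof -
  obtain l ls' where ls: "ls = l # ls'"
    using assms(2) by (cases ls) auto
  have l: "l \<noteq> 0" and ls'0: "0 \<notin> set ls'" using assms(3) ls by auto
  note h = prob_density_scaled_centered[OF assms(1) l]
  show ?thesis
  proof (cases "ls' = []")
    case True
    have "continuous_on UNIV (scaled_centered_density g l)"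
      unfolding scaled_centered_density_def[abs_def]
      using assms True ls l
      by (intro continuous_intros continuous_on_compose2[OF continuous_gamma_density]) auto
    moreover have "integrable lborel (fourier (scaled_centered_density g l))"
      using integrable_fourier_weighted_sum[OF assms(1) _ assms(3)] assms(2) True ls by simp
    ultimately show ?thesis
      using continuous_density_eq_inverse_fourier[OF h] True ls by simp
  next
    case False
    \<comment> \<open>\<open>g\<close> and \<open>g * length ls'\<close> add up to at least 5 and
      the second is the larger, so it is at least 5/2.\<close>
    have "g * 1 \<le> g * length ls'"
      using assms(1) False by (intro mult_left_mono) (auto simp: Suc_le_eq)
    then have "2 \<le> g * length ls'"
      using assms(2) ls by (simp add: distrib_left)
    note F = integrable_fourier_weighted_sum[OF assms(1) this ls'0]
    note w = prob_density_weighted_sum[OF assms(1) False ls'0]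
    have "fourier (conv_density (scaled_centered_density g l) (weighted_sum_density g ls'))
      = (\<lambda>s. fourier (scaled_centered_density g l) s * fourier (weighted_sum_density g ls') s)"
      using fourier_conv[OF h w] by auto
    then show ?thesis
      using conv_density_eq_inverse_fourier[OF h w F] by (simp add: ls weighted_sum_density_Cons[OF False])
  qed
qed

text \<open>Dominated convergence. The majorant is assumed only eventually, since the uniform decay
  is available only for large \<open>n\<close>; the proof shifts the sequence accordingly.\<close>

lemma inverse_fourier_tendsto:
  assumes meas: "\<forall>\<^sub>F n in sequentially. F n \<in> borel_measurable borel"
    and bound: "\<forall>\<^sub>F n in sequentially. \<forall>t. norm (F n t) \<le> w t"
    and w: "integrable lborel w" and lim: "\<And>t. (\<lambda>n. F n t) \<longlonglongrightarrow> G t"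
    and G: "G \<in> borel_measurable borel"
  shows "(\<lambda>n. inverse_fourier (F n) x) \<longlonglongrightarrow> inverse_fourier G x"
proof -
  obtain N where N: "\<And>n. n \<ge> N \<Longrightarrow> F n \<in> borel_measurable borel" "\<And>n t. n \<ge> N \<Longrightarrow> norm (F n t) \<le> w t"
    using eventually_conj[OF meas bound] by (auto simp: eventually_sequentially)
  note [measurable] = N(1)[OF le_add2] G
  have "(\<lambda>n. CLBINT t. iexp (- (t * x)) * F (n + N) t) \<longlonglongrightarrow> (CLBINT t. iexp (- (t * x)) * G t)"
  proof (rule integral_dominated_convergence[where w=w])
    show "AE t in lborel. (\<lambda>n. iexp (- (t * x)) * F (n + N) t) \<longlonglongrightarrow> iexp (- (t * x)) * G t"
      by (intro AE_I2 tendsto_intros LIMSEQ_ignore_initial_segment lim)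
    show "AE t in lborel. norm (iexp (- (t * x)) * F (n + N) t) \<le> w t" for n
      using N(2)[of "n + N"] by (simp add: norm_mult)
  qed (use w in measurable)
  then have "(\<lambda>n. inverse_fourier (F (n + N)) x) \<longlonglongrightarrow> inverse_fourier G x"
    unfolding inverse_fourier_def by (intro tendsto_intros)
  then show ?thesis by (rule LIMSEQ_offset)
qed

subsection \<open>Convergence of the densities\<close>

lemma char_scaled_centered:
  assumes "prob_space M" "g > 0" "l \<noteq> 0" "distributed M lborel Y (\<lambda>x. ennreal (gamma_density g x))"
  shows "char (distr M borel (\<lambda>\<omega>. l * (Y \<omega> - g))) t = fourier (scaled_centered_density g l) t"
proof -
  interpret prob_space M by fact
  have Y [measurable]: "Y \<in> borel_measurable M"
    using distributed_measurable[OF assms(4)] by simp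
  have "iexp (t * (l * (y - g))) = iexp (- (t * (l * g))) * iexp (l * t * y)" for y
    by (simp add: exp_add[symmetric] algebra_simps)
  then have "char (distr M borel (\<lambda>\<omega>. l * (Y \<omega> - g))) t = (CLINT \<omega>|M. iexp (- (t * (l * g))) * iexp (l * t * Y \<omega>))"
    by (simp add: char_def integral_distr del: of_real_mult of_real_diff of_real_minus)
  also have "\<dots> = iexp (- (t * (l * g))) * (CLINT \<omega>|M. iexp (l * t * Y \<omega>))"
    by (rule integral_mult_right_zero)
  also have "(CLINT \<omega>|M. iexp (l * t * Y \<omega>)) = char (distr M lborel Y) (l * t)"
    by (simp add: char_def integral_distr)
  also have "\<dots> = fourier (gamma_density g) (l * t)"
    by (simp add: distributed_distr_eq_density[OF assms(4)] char_density[OF prob_density_gamma[OF assms(2)]])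
  finally show ?thesis
    by (simp only: fourier_scaled_centered[OF assms(3)])
qed

text \<open>Independence yields the same product that \<open>fourier_weighted_sum\<close> finds for
  the iterated convolution, which links the random variables to the densities. For
  \<open>k = 0\<close> it is the empty product.\<close>

lemma char_weighted_sum:
  fixes Y :: "nat \<Rightarrow> 'a \<Rightarrow> real"
  assumes M: "prob_space M" and "g > 0"
    and indep: "prob_space.indep_vars M (\<lambda>_. borel) Y {1..}"
    and Y: "\<And>i. i \<ge> 1 \<Longrightarrow> distributed M lborel (Y i) (\<lambda>x. ennreal (gamma_density g x))"
    and l: "\<And>i. 1 \<le> i \<Longrightarrow> i \<le> k \<Longrightarrow> l i \<noteq> 0"
  shows "char (distr M borel (\<lambda>\<omega>. (\<Sum>i=1..k. l i * (Y i \<omega> - g)) + \<alpha>)) t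
    = iexp (t * \<alpha>) * (\<Prod>x\<leftarrow>map l [1..<Suc k]. fourier (scaled_centered_density g x) t)"
proof -
  interpret prob_space M by fact
  let ?Z = "\<lambda>i \<omega>. l i * (Y i \<omega> - g)"
  have "indep_vars (\<lambda>_. borel) Y {1..k}"
    by (rule indep_vars_subset[OF indep]) auto
  from indep_vars_compose2[OF this, of "\<lambda>i y. l i * (y - g)" "\<lambda>_. borel"]
  have indep_Z: "indep_vars (\<lambda>_. borel) ?Z {1..k}"
    by simp
  have [measurable]: "?Z i \<in> borel_measurable M" if "i \<in> {1..k}" for i
    using distributed_measurable[OF Y[of i]] that by simp
  have "iexp (t * (z + \<alpha>)) = iexp (t * \<alpha>) * iexp (t * z)" for z
    by (simp add: exp_add[symmetric] algebra_simps)
  then have "char (distr M borel (\<lambda>\<omega>. (\<Sum>i=1..k. ?Z i \<omega>) + \<alpha>)) t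
     = (CLINT \<omega>|M. iexp (t * \<alpha>) * iexp (t * (\<Sum>i=1..k. ?Z i \<omega>)))"
    by (simp add: char_def integral_distr del: of_real_mult of_real_add of_real_sum)
  also have "\<dots> = iexp (t * \<alpha>) * (CLINT \<omega>|M. iexp (t * (\<Sum>i=1..k. ?Z i \<omega>)))"
    by (rule integral_mult_right_zero)
  also have "(CLINT \<omega>|M. iexp (t * (\<Sum>i=1..k. ?Z i \<omega>))) = char (distr M borel (\<lambda>\<omega>. \<Sum>i=1..k. ?Z i \<omega>)) t"
    by (simp add: char_def integral_distr del: of_real_mult of_real_sum)
  also have "\<dots> = (\<Prod>i=1..k. char (distr M borel (?Z i)) t)"
    by (rule char_distr_sum[OF indep_Z])
  also have "\<dots> = (\<Prod>i=1..k. fourier (scaled_centered_density g (l i)) t)"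
    by (intro prod.cong refl char_scaled_centered M \<open>g > 0\<close> Y l) auto
  also have "\<dots> = (\<Prod>x\<leftarrow>map l [1..<Suc k]. fourier (scaled_centered_density g x) t)"
    using prod.distinct_set_conv_list[of "[1..<Suc k]" "\<lambda>i. fourier (scaled_centered_density g (l i)) t"]
    by (simp add: atLeastLessThanSuc_atLeastAtMost comp_def del: upt_Suc)
  finally show ?thesis .
qed

theorem theorem6p1:
  fixes M :: "'a measure"
    and Y :: "nat \<Rightarrow> 'a \<Rightarrow> real"
    and g \<alpha> :: real
    and k :: "nat \<Rightarrow> nat"
    and lam :: "nat \<Rightarrow> nat \<Rightarrow> real"
    and X :: "nat \<Rightarrow> 'a \<Rightarrow> real"
  assumes "prob_space M"
    and "g > 0" and "\<alpha> > 0"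
    and "prob_space.indep_vars M (\<lambda>_. borel) Y {1..}"
    and "\<And>i. i \<ge> 1 \<Longrightarrow> distributed M lborel (Y i) (\<lambda>x. ennreal (gamma_density g x))"
    and "\<And>n. X n = (\<lambda>\<omega>. \<Sum>i=1..k n. lam i n * (Y i \<omega> - g))"
    and "\<And>n i. 1 \<le> i \<Longrightarrow> i < k n \<Longrightarrow> \<bar>lam i n\<bar> \<ge> \<bar>lam (Suc i) n\<bar>"
    and "\<And>n i. 1 \<le> i \<Longrightarrow> i \<le> k n \<Longrightarrow> lam i n \<noteq> 0"
    and "weak_conv_m (\<lambda>n. distr M borel (\<lambda>\<omega>. X n \<omega> + \<alpha>))
                     (density lborel (\<lambda>x. ennreal (gamma_density \<alpha> x)))"
    and "\<alpha> > 6"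
  shows "\<forall>x::real.
    (\<lambda>n. weighted_sum_density g (map (\<lambda>i. lam i n) [1..<Suc (k n)]) (x - \<alpha>))
      \<longlonglongrightarrow> gamma_density \<alpha> x"
proof
  fix x :: real
  interpret prob_space M by fact
  note G = prob_density_gamma[OF \<open>\<alpha> > 0\<close>]
  define ls where "ls n = map (\<lambda>i. lam i n) [1..<Suc (k n)]" for n
  \<comment> \<open>Defined through the product instead of the density, so that it is the
    characteristic function of X_n + \<alpha> for every \<open>n\<close>, even for an empty
    sum.\<close>
  define F where "F n t = iexp (t * \<alpha>) * (\<Prod>l\<leftarrow>ls n. fourier (scaled_centered_density g l) t)" for n t
  have ls0: "0 \<notin> set (ls n)" for n
    using assms(8)[of _ n] by (force simp: ls_def simp del: upt_Suc)
  have [measurable]: "Y i \<in> borel_measurable M" if "i \<ge> 1" for i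
    using distributed_measurable[OF assms(5)[OF that]] by simp
  have F_char: "F n t = char (distr M borel (\<lambda>\<omega>. X n \<omega> + \<alpha>)) t" for n t
    unfolding F_def ls_def assms(6)
    by (rule char_weighted_sum[OF assms(1,2,4,5,8), symmetric])
  have rd: "real_distribution (distr M borel (\<lambda>\<omega>. X n \<omega> + \<alpha>))" for n
  proof (rule real_distribution_distr)
    show "(\<lambda>\<omega>. X n \<omega> + \<alpha>) \<in> borel_measurable M"
      unfolding assms(6) by measurable
  qed
  have lim: "(\<lambda>n. F n t) \<longlonglongrightarrow> fourier (gamma_density \<alpha>) t" for t
    unfolding F_char char_density[OF G, symmetric]
    by (rule levy_continuity1[OF rd real_distribution_density[OF G] assms(9)])
  have norm_F: "norm (F n t) = char_modulus g (ls n) t" for n t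
    by (simp only: F_def norm_mult norm_exp_i_times norm_prod_fourier_eq_char_modulus[OF \<open>g > 0\<close> ls0] mult_1)
  have lim_modulus: "(\<lambda>n. char_modulus g (ls n) t) \<longlonglongrightarrow> (1 + t\<^sup>2) powr (- \<alpha> / 2)" for t
    using tendsto_norm[OF lim[of t]] by (simp only: norm_F norm_fourier_gamma[OF \<open>\<alpha> > 0\<close>])
  \<comment> \<open>5 and 17 are the values of 1 + t^2 at 2 and 4. Here \<open>\<alpha> > 6\<close>
    is decisive: (17/5)^(\<alpha>/2) is at least (17/5)^3, which is about 39.\<close>
  have "32 * 17 powr (- \<alpha> / 2) < (5::real) powr (- \<alpha> / 2)"
  proof -
    have "(32::real) < (17 / 5) ^ 3" by (simp add: power3_eq_cube)
    also have "\<dots> = (17 / 5) powr 3" by simp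
    also have "\<dots> \<le> (17 / 5) powr (\<alpha> / 2)"
      using \<open>\<alpha> > 6\<close> by (intro powr_mono) auto
    also have "\<dots> = 17 powr (\<alpha> / 2) / 5 powr (\<alpha> / 2)"
      by (rule powr_divide)
    finally show ?thesis
      by (simp add: powr_minus field_simps)
  qed
  moreover have "(\<lambda>n. char_modulus g (ls n) 2 - 32 * char_modulus g (ls n) 4) \<longlonglongrightarrow> 5 powr (- \<alpha> / 2) - 32 * 17 powr (- \<alpha> / 2)"
    using lim_modulus[of 2] lim_modulus[of 4] by (intro tendsto_intros) simp_all
  ultimately have "\<forall>\<^sub>F n in sequentially. 0 < char_modulus g (ls n) 2 - 32 * char_modulus g (ls n) 4"
    by (intro order_tendstoD) auto
  then have ev: "\<forall>\<^sub>F n in sequentially. 32 * char_modulus g (ls n) 4 \<le> char_modulus g (ls n) 2"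
    by eventually_elim simp
  have F_fourier: "F n = (\<lambda>t. iexp (t * \<alpha>) * fourier (weighted_sum_density g (ls n)) t)" if "ls n \<noteq> []" for n
    using that by (auto simp: F_def fourier_weighted_sum[OF \<open>g > 0\<close> _ ls0])
  have eq: "weighted_sum_density g (ls n) (x - \<alpha>) = Re (inverse_fourier (F n) x)"
    if "32 * char_modulus g (ls n) 4 \<le> char_modulus g (ls n) 2" for n
  proof -
    have len: "5 \<le> g * length (ls n)"
      by (rule length_ge_of_drop[OF \<open>g > 0\<close> that])
    then have "ls n \<noteq> []" by auto
    \<comment> \<open>Evaluating at \<open>x - \<alpha>\<close> produces exactly the phase by which
      \<open>F n\<close> differs from the transform of the density.\<close>
    have "iexp (- (t * (x - \<alpha>))) = iexp (- (t * x)) * iexp (t * \<alpha>)" for t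
      by (simp add: exp_add[symmetric] algebra_simps)
    then have "inverse_fourier (fourier (weighted_sum_density g (ls n))) (x - \<alpha>) = inverse_fourier (F n) x"
      by (simp only: inverse_fourier_def F_fourier[OF \<open>ls n \<noteq> []\<close>] mult.assoc)
    then show ?thesis
      using weighted_sum_density_eq_inverse_fourier[OF \<open>g > 0\<close> len ls0] by simp
  qed
  have "(\<lambda>n. inverse_fourier (F n) x) \<longlonglongrightarrow> inverse_fourier (fourier (gamma_density \<alpha>)) x"
  proof (rule inverse_fourier_tendsto[where w="\<lambda>t. 32 / (1 + t\<^sup>2)"])
    have "F n = char (distr M borel (\<lambda>\<omega>. X n \<omega> + \<alpha>))" for n
      using F_char by auto
    then show "\<forall>\<^sub>F n in sequentially. F n \<in> borel_measurable borel"
      using real_distribution.char_measurable[OF rd] by simp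
    show "\<forall>\<^sub>F n in sequentially. \<forall>t. norm (F n t) \<le> 32 / (1 + t\<^sup>2)"
      using ev
    proof eventually_elim
      case (elim n)
      \<comment> \<open>A factor 4 suffices for the majorant; the full 32 serves the length bound in
        \<open>eq\<close>.\<close>
      then have "4 * char_modulus g (ls n) 4 \<le> char_modulus g (ls n) 2"
        using char_modulus_pos[of g "ls n" 4] by linarith
      then show ?case
        unfolding norm_F by (intro allI char_modulus_decay[OF \<open>g > 0\<close>])
    qed
  qed (use lim integrable_inverse_one_plus_square fourier_measurable[OF G] in auto)
  from tendsto_Re[OF this] have "(\<lambda>n. Re (inverse_fourier (F n) x)) \<longlonglongrightarrow> gamma_density \<alpha> x"
    using continuous_density_eq_inverse_fourier[OF G integrable_fourier_gamma continuous_gamma_density] \<open>\<alpha> > 6\<close>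
    by simp
  moreover have "\<forall>\<^sub>F n in sequentially. Re (inverse_fourier (F n) x) = weighted_sum_density g (ls n) (x - \<alpha>)"
    using ev by eventually_elim (simp add: eq)
  ultimately have "(\<lambda>n. weighted_sum_density g (ls n) (x - \<alpha>)) \<longlonglongrightarrow> gamma_density \<alpha> x"
    by (rule Lim_transform_eventually)
  then show "(\<lambda>n. weighted_sum_density g (map (\<lambda>i. lam i n) [1..<Suc (k n)]) (x - \<alpha>)) \<longlonglongrightarrow> gamma_density \<alpha> x"
    unfolding ls_def .
qed

end
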